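(* Consider the spiked covariance setup described in the context, with sparsity level $k$, dimension $d$, number of samples $n$, spike $A^\sharp$ and sample covariance matrix $y$. The learning machine $$\max_{A\in\mathcal{A}}\ \langle y,A\rangle=\max_{u\in\mathbb{R}^{d}}\big\{u^\top y u:\ \|u\|_2=1,\ \|u\|_0\le k\big\}$$ asymptotically returns the spike $A^\sharp$. More specifically, consider a sequence $\{k_l,d_l,n_l\}_l$ of values of $(k,d,n)$ such that $\lim_{l\to\infty}n_l=\infty$. Suppose that $$\lim_{l\to\infty}\frac{k_l\log d_l}{n_l}=0.$$ Then, in the limit of $l\to\infty$, solving the optimization problem $$\max_{u\in\mathbb{R}^{d}}\big\{u^\top y u:\ \|u\|_2=1,\ \|u\|_0\le k\big\}$$ (with $k=k_l$, $d=d_l$, $n=n_l$) returns a vector $u^\sharp\in\mathbb{R}^{d}$ such that $u^\sharp(u^\sharp)^\top=A^\sharp$, with a probability that approaches one.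
   Context: For a vector $u$, $\|u\|_0$ is the number of its nonzero entries. For sparsity level $k$ and dimension $d$, the alphabet is $\mathcal{A}=\{uu^\top:\ \|u\|_2=1,\ \|u\|_0\le k,\ u\in\mathbb{R}^d\}\subset\mathbb{R}^{d\times d}$. Spiked covariance setup: $\theta\in[0,1)$, the covariance matrix is $\Sigma=A^\sharp+\theta I_d$, where $A^\sharp=u^\sharp(u^\sharp)^\top\in\mathcal{A}$ is the spike and $I_d$ is the $d\times d$ identity matrix. The samples $z_1,\dots,z_n\in\mathbb{R}^d$ are drawn independently from the zero-mean Gaussian distribution $\mathrm{normal}(0,\Sigma)$, and $y=\frac1n\sum_{i=1}^n z_iz_i^\top$ is the sample covariance matrix; equivalently, $y=A^\sharp+e$ with $e=\frac1n\sum_{i=1}^n z_iz_i^\top-A^\sharp$. $\langle\cdot,\cdot\rangle$ is the standard (trace) inner product of matrices.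
   Formalization: The equality of the returned matrix with the spike is read as convergence in probability: for every ε>0, every maximizer is within ε of the spike in Frobenius norm with probability tending to one; exact equality at finite l fails, e.g. for k=d=2 and 0<θ<1. *)

theory Defs
  imports "HOL-Probability.Probability" "Jordan_Normal_Form.Matrix"
begin

(* The dimension varies along a sequence, so vectors and matrices are those of
   Jordan_Normal_Form; the type-indexed ones of HOL-Analysis are not used. *)
unbundle no vec_syntax
unbundle no inner_syntax

definition l0_norm :: "real vec \<Rightarrow> nat" where
  "l0_norm u = card {i. i < dim_vec u \<and> u $ i \<noteq> 0}"

definition l2_norm :: "real vec \<Rightarrow> real" where
  "l2_norm u = sqrt (\<Sum>i<dim_vec u. (u $ i)\<^sup>2)"

definition outer :: "real vec \<Rightarrow> real mat" where
  "outer u = mat (dim_vec u) (dim_vec u) (\<lambda>(i, j). u $ i * u $ j)"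

definition sparse_unit :: "nat \<Rightarrow> nat \<Rightarrow> real vec set" where
  "sparse_unit k d = {u \<in> carrier_vec d. l2_norm u = 1 \<and> l0_norm u \<le> k}"

definition alphabet :: "nat \<Rightarrow> nat \<Rightarrow> real mat set" where
  "alphabet k d = outer ` sparse_unit k d"

(* For matrices of equal dimensions this is the trace of the product of
   the transpose of A with B. *)
definition mat_inner :: "real mat \<Rightarrow> real mat \<Rightarrow> real" where
  "mat_inner A B = (\<Sum>i<dim_row A. \<Sum>j<dim_col A. A $$ (i, j) * B $$ (i, j))"

definition frobenius_norm :: "real mat \<Rightarrow> real" where
  "frobenius_norm A = sqrt (mat_inner A A)"

definition spiked_cov :: "nat \<Rightarrow> real \<Rightarrow> real mat \<Rightarrow> real mat" where
  "spiked_cov d \<theta> A = A + \<theta> \<cdot>\<^sub>m 1\<^sub>m d"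

(* The Borel sigma-algebra on the vectors of dimension d: it is generated by
   the coordinates. *)
definition vec_borel :: "nat \<Rightarrow> real vec measure" where
  "vec_borel d = vimage_algebra (carrier_vec d) (\<lambda>v. \<lambda>i\<in>{..<d}. v $ i) (\<Pi>\<^sub>M i\<in>{..<d}. borel)"

(* The normal law on the reals with mean m and variance v \<ge> 0; for v = 0 it is
   the point mass at m. *)
definition normal_law :: "real \<Rightarrow> real \<Rightarrow> real measure" where
  "normal_law m v = distr std_normal_distribution borel (\<lambda>x. m + sqrt v * x)"

(* Z has the law normal(m, S) on the vectors of dimension d: every linear
   functional of Z is normal with the mean and variance that m and S prescribe.
   Unlike a definition by densities, this covers singular S; the spiked
   covariance matrix with \<theta> = 0 is singular as soon as d > 1. *)
definition normal_vec ::
  "'a measure \<Rightarrow> nat \<Rightarrow> real vec \<Rightarrow> real mat \<Rightarrow> ('a \<Rightarrow> real vec) \<Rightarrow> bool" where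
  "normal_vec M d m S Z \<longleftrightarrow>
     Z \<in> measurable M (vec_borel d) \<and>
     (\<forall>t\<in>carrier_vec d.
        distr M borel (\<lambda>\<omega>. t \<bullet> Z \<omega>) = normal_law (t \<bullet> m) (t \<bullet> (S *\<^sub>v t)))"

definition sample_cov :: "nat \<Rightarrow> nat \<Rightarrow> (nat \<Rightarrow> real vec) \<Rightarrow> real mat" where
  "sample_cov d n z = (1 / real n) \<cdot>\<^sub>m mat d d (\<lambda>(a, b). \<Sum>i<n. outer (z i) $$ (a, b))"

definition solves_matrix :: "nat \<Rightarrow> nat \<Rightarrow> real mat \<Rightarrow> real mat \<Rightarrow> bool" where
  "solves_matrix k d y = is_arg_max (\<lambda>A. mat_inner y A) (\<lambda>A. A \<in> alphabet k d)"

definition solves_vector :: "nat \<Rightarrow> nat \<Rightarrow> real mat \<Rightarrow> real vec \<Rightarrow> bool" where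
  "solves_vector k d y = is_arg_max (\<lambda>u. u \<bullet> (y *\<^sub>v u)) (\<lambda>u. u \<in> sparse_unit k d)"

end

theory Submission
  imports Defs
begin

text \<open>
  For a unit vector u, the population objective is (u . a)^2 + theta, where a is a spike vector,
  and the squared Frobenius distance from u u^T to a a^T is 2 - 2 (u . a)^2. So a maximizer of the
  sample objective is close to the spike as soon as the two objectives are uniformly close on
  sparse unit vectors. For a single vector w of norm at most 1, the sample objective is a mean of
  squares of independent centred Gaussians, for which a Chernoff bound applies. Uniformity comes
  from a union bound over a scaled integer grid: truncating the coordinates of a k-sparse unit
  vector to multiples of 1 / (4 sqrt k) moves it by at most 1/4 within its support and leaves an
  integer vector of l1 norm at most 16 k, and there are at most (2 d + 1)^(16 k) of these, that is
  at most exp (48 k log d) for d at least 2.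
\<close>

section \<open>Means of squares of Gaussian variables\<close>

text \<open>Exponential tilting: multiplying the standard normal density by
  \<open>exp (s * x^2)\<close> yields \<open>\<sigma>\<close> times the centred normal density of
  variance \<open>1 / (1 - 2 * s)\<close>, whose total mass is 1.\<close>

lemma std_normal_square_mgf:
  fixes s :: real
  assumes "s < 1 / 2"
  shows "(\<integral>\<^sup>+x. ennreal (exp (s * x\<^sup>2)) \<partial>std_normal_distribution) = ennreal (1 / sqrt (1 - 2 * s))"
proof -
  define \<sigma> where "\<sigma> = 1 / sqrt (1 - 2 * s)"
  have pos: "\<sigma> > 0" and sq: "\<sigma>\<^sup>2 = 1 / (1 - 2 * s)"
    using assms by (auto simp: \<sigma>_def power_divide)
  have eq: "std_normal_density x * exp (s * x\<^sup>2) = \<sigma> * normal_density 0 \<sigma> x" for x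
  proof -
    have "- (x\<^sup>2) / 2 + s * x\<^sup>2 = - (x\<^sup>2 / (2 * \<sigma>\<^sup>2))"
      unfolding sq using assms by (simp add: field_simps)
    then have "exp (- (x\<^sup>2) / 2) * exp (s * x\<^sup>2) = exp (- (x\<^sup>2 / (2 * \<sigma>\<^sup>2)))"
      by (simp flip: exp_add)
    then show ?thesis
      using pos by (simp add: normal_density_def real_sqrt_mult)
  qed
  interpret N: prob_space "density lborel (normal_density 0 \<sigma>)"
    using pos by (rule prob_space_normal_density)
  have "(\<integral>\<^sup>+x. ennreal (exp (s * x\<^sup>2)) \<partial>std_normal_distribution)
      = (\<integral>\<^sup>+x. ennreal (std_normal_density x * exp (s * x\<^sup>2)) \<partial>lborel)"
    by (subst nn_integral_density) (auto simp: ennreal_mult)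
  also have "\<dots> = (\<integral>\<^sup>+x. ennreal \<sigma> * ennreal (normal_density 0 \<sigma> x) \<partial>lborel)"
    using pos by (simp add: eq ennreal_mult)
  also have "\<dots> = ennreal \<sigma> * (\<integral>\<^sup>+x. ennreal (normal_density 0 \<sigma> x) \<partial>lborel)"
    by (rule nn_integral_cmult) auto
  also have "(\<integral>\<^sup>+x. ennreal (normal_density 0 \<sigma> x) \<partial>lborel) = 1"
    using N.emeasure_space_1 by (simp add: emeasure_density)
  finally show ?thesis by (simp add: \<sigma>_def)
qed

text \<open>The logarithm of the left side is \<open>- ln (1 - 2 * s) / 2\<close>. With
  \<open>x = - 2 * s\<close>, the bound \<open>\<bar>ln (1 + x) - x\<bar> \<le> 2 * x^2\<close> for
  \<open>\<bar>x\<bar> \<le> 1 / 2\<close> leaves an error of \<open>8 * s^2\<close>, which halving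
  turns into \<open>4 * s^2\<close>.\<close>

lemma inverse_sqrt_le_exp:
  fixes s :: real
  assumes "\<bar>s\<bar> \<le> 1 / 4"
  shows "1 / sqrt (1 - 2 * s) \<le> exp (s + 4 * s\<^sup>2)"
proof -
  have pos: "1 - 2 * s > 0" using assms by auto
  have "\<bar>ln (1 + (- 2 * s)) - (- 2 * s)\<bar> \<le> 2 * (- 2 * s)\<^sup>2"
    using assms by (intro abs_ln_one_plus_x_minus_x_bound) auto
  then have "ln (1 - 2 * s) \<ge> - 2 * s - 8 * s\<^sup>2" by (auto simp: power2_eq_square)
  then have "- (s + 4 * s\<^sup>2) \<le> ln (sqrt (1 - 2 * s))" using pos by (simp add: ln_sqrt)
  then have "exp (- (s + 4 * s\<^sup>2)) \<le> sqrt (1 - 2 * s)" using pos by (simp add: ln_ge_iff)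
  then have "1 / sqrt (1 - 2 * s) \<le> 1 / exp (- (s + 4 * s\<^sup>2))"
    using pos by (intro divide_left_mono) auto
  then show ?thesis by (metis exp_minus inverse_eq_divide inverse_inverse_eq)
qed

text \<open>\<open>X\<close> is distributed as \<open>sqrt v\<close> times a standard normal
  variable, so the integral is the standard one at \<open>s = c * v\<close>. The point mass at
  \<open>v = 0\<close> is included.\<close>

lemma (in prob_space) square_mgf_le:
  assumes X: "random_variable borel X" and law: "distr M borel X = normal_law 0 v"
    and v: "0 \<le> v" "\<bar>c * v\<bar> \<le> 1 / 4"
  shows "(\<integral>\<^sup>+\<omega>. ennreal (exp (c * (X \<omega>)\<^sup>2)) \<partial>M) \<le> ennreal (exp (c * v + 4 * (c * v)\<^sup>2))"
proof -
  have "(\<integral>\<^sup>+\<omega>. ennreal (exp (c * (X \<omega>)\<^sup>2)) \<partial>M)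
      = (\<integral>\<^sup>+x. ennreal (exp (c * x\<^sup>2)) \<partial>distr M borel X)"
    using X by (simp add: nn_integral_distr)
  also have "\<dots> = (\<integral>\<^sup>+x. ennreal (exp (c * v * x\<^sup>2)) \<partial>std_normal_distribution)"
    unfolding law normal_law_def using v
    by (subst nn_integral_distr) (auto simp: power_mult_distrib mult_ac)
  also have "\<dots> = ennreal (1 / sqrt (1 - 2 * (c * v)))"
    using v by (intro std_normal_square_mgf) auto
  also have "\<dots> \<le> ennreal (exp (c * v + 4 * (c * v)\<^sup>2))"
    using v by (intro ennreal_leI inverse_sqrt_le_exp)
  finally show ?thesis .
qed

text \<open>Chernoff bound for both tails at once: positive \<open>c\<close> gives the upper tail,
  negative \<open>c\<close> the lower one. The linear term \<open>n * c * v\<close> of the exponent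
  cancels against the centring, so that only the remainder \<open>16 * c^2\<close> competes with the
  threshold \<open>a\<close>.\<close>

lemma (in prob_space) mean_square_one_sided_tail:
  fixes X :: "nat \<Rightarrow> 'a \<Rightarrow> real"
  assumes indep: "indep_vars (\<lambda>_. borel) X {..<n}"
    and law: "\<And>i. i < n \<Longrightarrow> distr M borel (X i) = normal_law 0 v"
    and v: "0 \<le> v" "v \<le> 2" and c: "\<bar>c\<bar> \<le> 1 / 8" and n: "n > 0"
  shows "emeasure M {\<omega> \<in> space M. c * ((\<Sum>i<n. (X i \<omega>)\<^sup>2) / real n - v) \<ge> a}
           \<le> ennreal (exp (real n * (16 * c\<^sup>2 - a)))"
proof -
  have X[measurable]: "random_variable borel (X i)" if "i < n" for i
    using indep that by (auto simp: indep_vars_def)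
  have cv: "\<bar>c * v\<bar> \<le> 1 / 4" using v c mult_mono[of "\<bar>c\<bar>" "1/8" v 2] by (auto simp: abs_mult)
  have "(c * v)\<^sup>2 \<le> c\<^sup>2 * 4"
    unfolding power_mult_distrib using v power_mono[of v 2 2] by (intro mult_left_mono) auto
  then have mgf: "4 * (c * v)\<^sup>2 \<le> 16 * c\<^sup>2" by simp
  have indep': "indep_vars (\<lambda>_. borel) (\<lambda>i \<omega>. ennreal (exp (c * (X i \<omega>)\<^sup>2))) {..<n}"
    by (rule indep_vars_compose2[OF indep]) measurable
  let ?f = "\<lambda>\<omega>. \<Sum>i<n. c * (X i \<omega>)\<^sup>2"
  let ?b = "real n * (a + c * v)"
  have "(\<integral>\<^sup>+\<omega>. ennreal (exp (1 * ?f \<omega>)) * indicator (space M) \<omega> \<partial>M)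
      = (\<integral>\<^sup>+\<omega>. (\<Prod>i<n. ennreal (exp (c * (X i \<omega>)\<^sup>2))) \<partial>M)"
    by (intro nn_integral_cong) (simp add: exp_sum prod_ennreal)
  also have "\<dots> = (\<Prod>i<n. \<integral>\<^sup>+\<omega>. ennreal (exp (c * (X i \<omega>)\<^sup>2)) \<partial>M)"
    by (rule indep_vars_nn_integral) (use indep' in auto)
  also have "\<dots> \<le> (\<Prod>i<n. ennreal (exp (c * v + 16 * c\<^sup>2)))"
  proof (rule prod_mono_ennreal)
    fix i assume "i \<in> {..<n}"
    have "(\<integral>\<^sup>+\<omega>. ennreal (exp (c * (X i \<omega>)\<^sup>2)) \<partial>M) \<le> ennreal (exp (c * v + 4 * (c * v)\<^sup>2))"
      using v cv law \<open>i \<in> {..<n}\<close> by (intro square_mgf_le) auto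
    also have "\<dots> \<le> ennreal (exp (c * v + 16 * c\<^sup>2))"
      using mgf by (intro ennreal_leI) auto
    finally show "(\<integral>\<^sup>+\<omega>. ennreal (exp (c * (X i \<omega>)\<^sup>2)) \<partial>M) \<le> ennreal (exp (c * v + 16 * c\<^sup>2))" .
  qed
  also have "\<dots> = ennreal (exp (real n * (c * v + 16 * c\<^sup>2)))"
    by (simp add: ennreal_power exp_of_nat_mult)
  finally have le: "(\<integral>\<^sup>+\<omega>. ennreal (exp (1 * ?f \<omega>)) * indicator (space M) \<omega> \<partial>M)
      \<le> ennreal (exp (real n * (c * v + 16 * c\<^sup>2)))" .
  have "{\<omega> \<in> space M. c * ((\<Sum>i<n. (X i \<omega>)\<^sup>2) / real n - v) \<ge> a} = {\<omega> \<in> space M. ?f \<omega> \<ge> ?b}"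
    using n by (auto simp: field_simps sum_distrib_left)
  also have "emeasure M \<dots> \<le> ennreal (exp (-1 * ?b)) *
      (\<integral>\<^sup>+\<omega>. ennreal (exp (1 * ?f \<omega>)) * indicator (space M) \<omega> \<partial>M)"
    by (rule Chernoff_ineq_nn_integral_ge) auto
  also have "\<dots> \<le> ennreal (exp (-1 * ?b)) * ennreal (exp (real n * (c * v + 16 * c\<^sup>2)))"
    by (intro mult_left_mono le) auto
  also have "\<dots> = ennreal (exp (real n * (16 * c\<^sup>2 - a)))"
    by (simp add: algebra_simps flip: ennreal_mult exp_add)
  finally show ?thesis .
qed

lemma (in prob_space) mean_square_tail:
  fixes X :: "nat \<Rightarrow> 'a \<Rightarrow> real"
  assumes indep: "indep_vars (\<lambda>_. borel) X {..<n}"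
    and law: "\<And>i. i < n \<Longrightarrow> distr M borel (X i) = normal_law 0 v"
    and v: "0 \<le> v" "v \<le> 2" and n: "n > 0" and \<delta>: "0 < \<delta>" "\<delta> \<le> 1"
  shows "prob {\<omega> \<in> space M. \<bar>(\<Sum>i<n. (X i \<omega>)\<^sup>2) / real n - v\<bar> > \<delta>}
           \<le> 2 * exp (- (real n * \<delta>\<^sup>2 / 64))"
proof -
  have X[measurable]: "random_variable borel (X i)" if "i < n" for i
    using indep that by (auto simp: indep_vars_def)
  let ?D = "\<lambda>\<omega>. (\<Sum>i<n. (X i \<omega>)\<^sup>2) / real n - v"
  \<comment> \<open>The exponent \<open>16 * c^2 - c * \<delta>\<close> is least at
    \<open>c = \<delta> / 32\<close>, with value \<open>- \<delta>^2 / 64\<close>; the threshold is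
    \<open>c * \<delta> = \<delta>^2 / 32\<close>. The opposite \<open>c\<close> with the same
    threshold serves the lower tail.\<close>
  let ?E = "\<lambda>c. {\<omega> \<in> space M. c * ?D \<omega> \<ge> \<delta>\<^sup>2 / 32}"
  have one_sided: "prob (?E c) \<le> exp (- (real n * \<delta>\<^sup>2 / 64))" if c: "c \<in> {\<delta> / 32, - \<delta> / 32}" for c
  proof -
    have "emeasure M (?E c) \<le> ennreal (exp (real n * (16 * c\<^sup>2 - \<delta>\<^sup>2 / 32)))"
      using c \<delta> by (intro mean_square_one_sided_tail indep law v n) auto
    also have "16 * c\<^sup>2 - \<delta>\<^sup>2 / 32 = - (\<delta>\<^sup>2 / 64)" using c by (auto simp: power_divide)
    finally show ?thesis by (simp add: emeasure_eq_measure)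
  qed
  have "{\<omega> \<in> space M. \<bar>?D \<omega>\<bar> > \<delta>} \<subseteq> ?E (\<delta> / 32) \<union> ?E (- \<delta> / 32)"
  proof safe
    fix \<omega> assume "\<omega> \<in> space M" "\<bar>?D \<omega>\<bar> > \<delta>" "\<not> \<delta>\<^sup>2 / 32 \<le> - \<delta> / 32 * ?D \<omega>"
    then have "\<delta> * ?D \<omega> > - (\<delta> * \<delta>)" by (simp add: power2_eq_square)
    then have "- \<delta> < ?D \<omega>"
      using \<delta> mult_less_cancel_left_pos[of \<delta> "- \<delta>" "?D \<omega>"] by simp
    then have "\<delta> \<le> ?D \<omega>" using \<open>\<bar>?D \<omega>\<bar> > \<delta>\<close> by linarith
    then have "\<delta> * \<delta> \<le> \<delta> * ?D \<omega>" using \<delta> by (intro mult_left_mono) auto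
    then show "\<delta>\<^sup>2 / 32 \<le> \<delta> / 32 * ?D \<omega>" by (simp add: power2_eq_square)
  qed
  then have "prob {\<omega> \<in> space M. \<bar>?D \<omega>\<bar> > \<delta>} \<le> prob (?E (\<delta> / 32) \<union> ?E (- \<delta> / 32))"
    by (intro finite_measure_mono) measurable
  also have "\<dots> \<le> prob (?E (\<delta> / 32)) + prob (?E (- \<delta> / 32))"
    by (intro measure_Un_le) measurable
  also have "\<dots> \<le> 2 * exp (- (real n * \<delta>\<^sup>2 / 64))"
    using one_sided[of "\<delta> / 32"] one_sided[of "- \<delta> / 32"] by auto
  finally show ?thesis .
qed

section \<open>Quadratic forms on sparse vectors\<close>

text \<open>Arguments are functions on \<open>nat\<close> of which only the values below
  \<open>d\<close> count. This avoids carrier conditions, and the product topology on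
  \<open>nat => real\<close> is at hand for compactness.\<close>

definition bilin :: "nat \<Rightarrow> (nat \<Rightarrow> nat \<Rightarrow> real) \<Rightarrow> (nat \<Rightarrow> real) \<Rightarrow> (nat \<Rightarrow> real) \<Rightarrow> real" where
  "bilin d E x y = (\<Sum>i<d. \<Sum>j<d. E i j * x i * y j)"

definition sq_norm :: "nat \<Rightarrow> (nat \<Rightarrow> real) \<Rightarrow> real" where
  "sq_norm d x = (\<Sum>i<d. (x i)\<^sup>2)"

text \<open>Vanishing from \<open>d\<close> on makes this a finite set of functions.\<close>

definition l1_int_ball :: "nat \<Rightarrow> nat \<Rightarrow> (nat \<Rightarrow> int) set" where
  "l1_int_ball d K = {m. (\<forall>i\<ge>d. m i = 0) \<and> (\<Sum>i<d. \<bar>m i\<bar>) \<le> int K}"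

lemma bilin_add_left: "bilin d E (\<lambda>i. x i + y i) w = bilin d E x w + bilin d E y w"
  and bilin_add_right: "bilin d E w (\<lambda>i. x i + y i) = bilin d E w x + bilin d E w y"
  and bilin_diff_left: "bilin d E (\<lambda>i. x i - y i) w = bilin d E x w - bilin d E y w"
  and bilin_diff_right: "bilin d E w (\<lambda>i. x i - y i) = bilin d E w x - bilin d E w y"
  by (simp_all add: bilin_def algebra_simps sum.distrib sum_subtractf)

lemma bilin_scale_left: "bilin d E (\<lambda>i. c * x i) w = c * bilin d E x w"
  and bilin_scale_right: "bilin d E w (\<lambda>i. c * x i) = c * bilin d E w x"
  by (simp_all add: bilin_def sum_distrib_left mult_ac)

lemma bilin_commute:
  assumes "\<And>i j. i < d \<Longrightarrow> j < d \<Longrightarrow> E i j = E j i"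
  shows "bilin d E x y = bilin d E y x"
proof -
  have "bilin d E x y = (\<Sum>j<d. \<Sum>i<d. E i j * x i * y j)"
    unfolding bilin_def by (rule sum.swap)
  also have "\<dots> = bilin d E y x"
    unfolding bilin_def using assms by (intro sum.cong) (auto simp: mult_ac)
  finally show ?thesis .
qed

lemma sq_norm_nonneg: "0 \<le> sq_norm d x"
  by (simp add: sq_norm_def sum_nonneg)

lemma sq_norm_scale: "sq_norm d (\<lambda>i. c * x i) = c\<^sup>2 * sq_norm d x"
  by (simp add: sq_norm_def sum_distrib_left power_mult_distrib)

lemma sq_norm_eq_0_iff: "sq_norm d x = 0 \<longleftrightarrow> (\<forall>i<d. x i = 0)"
  by (auto simp: sq_norm_def sum_nonneg_eq_0_iff)

lemma parallelogram:
  "sq_norm d (\<lambda>i. x i + y i) + sq_norm d (\<lambda>i. x i - y i) = 2 * sq_norm d x + 2 * sq_norm d y"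
  by (simp add: sq_norm_def power2_eq_square algebra_simps sum.distrib sum_subtractf)

lemma coord_le_1:
  assumes "sq_norm d x \<le> 1" "i < d"
  shows "\<bar>x i\<bar> \<le> 1"
proof -
  have "(x i)\<^sup>2 \<le> sq_norm d x"
    unfolding sq_norm_def using assms by (intro member_le_sum) auto
  then have "(x i)\<^sup>2 \<le> 1" using assms by linarith
  then show ?thesis by (simp only: abs_square_le_1)
qed

text \<open>A crude bound, whose purpose is that the supremum of the form over a unit sphere is
  finite.\<close>

lemma bilin_bounded:
  assumes "sq_norm d x \<le> 1"
  shows "\<bar>bilin d E x x\<bar> \<le> (\<Sum>i<d. \<Sum>j<d. \<bar>E i j\<bar>)"
  unfolding bilin_def
proof (intro order.trans[OF sum_abs] sum_mono)
  fix i j assume "i \<in> {..<d}" "j \<in> {..<d}"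
  then have "\<bar>E i j\<bar> * (\<bar>x i\<bar> * \<bar>x j\<bar>) \<le> \<bar>E i j\<bar> * (1 * 1)"
    using assms by (intro mult_mono coord_le_1) auto
  then show "\<bar>E i j * x i * x j\<bar> \<le> \<bar>E i j\<bar>"
    by (simp add: abs_mult mult_ac)
qed

text \<open>Homogeneity of degree two: scaling \<open>x\<close> to norm 1 keeps its support inside
  \<open>T\<close>. At norm zero the form vanishes too, as only coordinates below \<open>d\<close>
  enter.\<close>

lemma bilin_le_of_unit:
  assumes S: "\<And>x. (\<forall>i. i \<notin> T \<longrightarrow> x i = 0) \<Longrightarrow> sq_norm d x = 1 \<Longrightarrow> \<bar>bilin d E x x\<bar> \<le> S"
    and x: "\<forall>i. i \<notin> T \<longrightarrow> x i = 0"
  shows "\<bar>bilin d E x x\<bar> \<le> S * sq_norm d x"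
proof (cases "sq_norm d x = 0")
  case True
  then have "bilin d E x x = 0" by (simp add: bilin_def sq_norm_eq_0_iff)
  then show ?thesis using True by simp
next
  case False
  define c where "c = 1 / sqrt (sq_norm d x)"
  have pos: "sq_norm d x > 0" using False sq_norm_nonneg[of d x] by simp
  have c2: "c\<^sup>2 = 1 / sq_norm d x" using pos by (simp add: c_def power_divide)
  have "\<bar>bilin d E (\<lambda>i. c * x i) (\<lambda>i. c * x i)\<bar> \<le> S"
    using x c2 pos by (intro S) (auto simp: sq_norm_scale)
  then have "c\<^sup>2 * \<bar>bilin d E x x\<bar> \<le> S"
    by (simp add: bilin_scale_left bilin_scale_right power2_eq_square abs_mult mult_ac)
  then show ?thesis unfolding c2 using pos by (simp add: field_simps)
qed

text \<open>Polarization writes \<open>4 * bilin d E x y\<close> as the difference of the quadratic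
  form at \<open>x + y\<close> and at \<open>x - y\<close>. Both vectors stay supported in
  \<open>T\<close>, and the parallelogram law adds up their norms. The argument covers indefinite
  forms, such as a difference of covariance matrices.\<close>

lemma bilin_polarization_le:
  assumes sym: "\<And>i j. i < d \<Longrightarrow> j < d \<Longrightarrow> E i j = E j i"
    and S: "\<And>x. (\<forall>i. i \<notin> T \<longrightarrow> x i = 0) \<Longrightarrow> sq_norm d x = 1 \<Longrightarrow> \<bar>bilin d E x x\<bar> \<le> S"
    and x: "\<forall>i. i \<notin> T \<longrightarrow> x i = 0" and y: "\<forall>i. i \<notin> T \<longrightarrow> y i = 0"
  shows "2 * \<bar>bilin d E x y\<bar> \<le> S * (sq_norm d x + sq_norm d y)"
proof -
  let ?p = "\<lambda>i. x i + y i" and ?q = "\<lambda>i. x i - y i"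
  have "bilin d E x y = bilin d E y x" using sym by (rule bilin_commute)
  then have "4 * bilin d E x y = bilin d E ?p ?p - bilin d E ?q ?q"
    by (simp add: bilin_add_left bilin_add_right bilin_diff_left bilin_diff_right)
  moreover have "\<bar>bilin d E ?p ?p\<bar> \<le> S * sq_norm d ?p" "\<bar>bilin d E ?q ?q\<bar> \<le> S * sq_norm d ?q"
    using x y by (auto intro!: bilin_le_of_unit[where T = T] S)
  ultimately have "4 * \<bar>bilin d E x y\<bar> \<le> S * (sq_norm d ?p + sq_norm d ?q)"
    by (simp add: distrib_left)
  then show ?thesis unfolding parallelogram by (simp add: algebra_simps)
qed

section \<open>Integer points of small l1 norm and approximation by a grid\<close>

lemma card_l1_int_ball:
  "finite (l1_int_ball d K) \<and> card (l1_int_ball d K) \<le> (2 * d + 1) ^ K"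
proof (induction K)
  case 0
  have "l1_int_ball d 0 \<subseteq> {\<lambda>_. 0}"
  proof
    fix m assume m: "m \<in> l1_int_ball d 0"
    have "(\<Sum>i<d. \<bar>m i\<bar>) = 0"
    proof (rule antisym)
      show "(\<Sum>i<d. \<bar>m i\<bar>) \<le> 0" using m by (simp add: l1_int_ball_def)
    qed (simp add: sum_nonneg)
    then have "m i = 0" for i
      using m by (cases "i < d") (auto simp: l1_int_ball_def sum_nonneg_eq_0_iff)
    then show "m \<in> {\<lambda>_. 0}" by auto
  qed
  then show ?case using card_mono[of "{\<lambda>_. 0}" "l1_int_ball d 0"] finite_subset by auto
next
  case (Suc K)
  \<comment> \<open>Zero and the \<open>2 * d\<close> signed unit vectors. Every point of the ball
    of radius \<open>Suc K\<close> is a point of the ball of radius \<open>K\<close> plus an element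
    of \<open>C\<close>, whence the factor \<open>2 * d + 1\<close>.\<close>
  define C :: "(nat \<Rightarrow> int) set"
    where "C = insert (\<lambda>_. 0) ((\<lambda>(i, s) j. if j = i then s else 0) ` ({..<d} \<times> {1, -1}))"
  have finC: "finite C" by (simp add: C_def)
  have "card C \<le> Suc (card ((\<lambda>(i, s) j. if j = i then s else 0 :: int) ` ({..<d} \<times> {1, -1})))"
    unfolding C_def by (rule card_insert_le_m1) auto
  also have "\<dots> \<le> Suc (card ({..<d} \<times> {1, -1 :: int}))"
    by (intro Suc_leI le_imp_less_Suc card_image_le) auto
  finally have cardC: "card C \<le> 2 * d + 1" by (simp add: card_cartesian_product)
  let ?add = "\<lambda>(m, c) j. m j + c j :: int"
  have sub: "l1_int_ball d (Suc K) \<subseteq> ?add ` (l1_int_ball d K \<times> C)"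
  proof
    fix m assume m: "m \<in> l1_int_ball d (Suc K)"
    show "m \<in> ?add ` (l1_int_ball d K \<times> C)"
    proof (cases "\<exists>i<d. m i \<noteq> 0")
      case False
      then have "m = (\<lambda>_. 0)" using m by (auto simp: l1_int_ball_def fun_eq_iff not_le[symmetric])
      then have "m = ?add (\<lambda>_. 0, \<lambda>_. 0)" by auto
      moreover have "(\<lambda>_. 0, \<lambda>_. 0) \<in> l1_int_ball d K \<times> C"
        by (auto simp: l1_int_ball_def C_def)
      ultimately show ?thesis by (rule image_eqI)
    next
      case True
      then obtain i where i: "i < d" "m i \<noteq> 0" by blast
      \<comment> \<open>Moving a nonzero coordinate one unit towards zero lowers the l1 norm by
        exactly one.\<close>
      define c where "c = (\<lambda>j. if j = i then sgn (m i) else 0)"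
      define m' where "m' = (\<lambda>j. m j - c j)"
      have rest: "(\<Sum>j\<in>{..<d} - {i}. \<bar>m' j\<bar>) = (\<Sum>j\<in>{..<d} - {i}. \<bar>m j\<bar>)"
        by (intro sum.cong) (auto simp: m'_def c_def)
      have "\<bar>m' i\<bar> = \<bar>m i\<bar> - 1" using i by (auto simp: m'_def c_def sgn_if)
      then have "(\<Sum>j<d. \<bar>m' j\<bar>) = (\<Sum>j<d. \<bar>m j\<bar>) - 1"
        using i rest sum.remove[of "{..<d}" i "\<lambda>j. \<bar>m' j\<bar>"] sum.remove[of "{..<d}" i "\<lambda>j. \<bar>m j\<bar>"]
        by simp
      then have "m' \<in> l1_int_ball d K"
        using m i by (auto simp: l1_int_ball_def m'_def c_def)
      moreover have "c \<in> C"
        using i unfolding C_def c_def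
        by (intro insertI2 image_eqI[of _ _ "(i, sgn (m i))"]) (auto simp: sgn_if)
      moreover have "m = ?add (m', c)" by (auto simp: m'_def)
      ultimately show ?thesis by (intro image_eqI[of _ _ "(m', c)"]) auto
    qed
  qed
  have fin: "finite (?add ` (l1_int_ball d K \<times> C))" using Suc finC by auto
  have "card (l1_int_ball d (Suc K)) \<le> card (?add ` (l1_int_ball d K \<times> C))"
    by (rule card_mono[OF fin sub])
  also have "\<dots> \<le> card (l1_int_ball d K \<times> C)"
    using Suc finC by (intro card_image_le) auto
  also have "\<dots> \<le> (2 * d + 1) ^ K * (2 * d + 1)"
    unfolding card_cartesian_product using Suc cardC by (intro mult_mono) auto
  finally show ?case using finite_subset[OF sub fin] by (simp add: algebra_simps)
qed

text \<open>Rounding goes towards zero, so that coordinatewise truncation never increases a norm and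
  never enlarges a support.\<close>

lemma truncate_int:
  fixes t :: real
  obtains m :: int where "\<bar>real_of_int m\<bar> \<le> \<bar>t\<bar>" "\<bar>t - real_of_int m\<bar> \<le> 1" "t = 0 \<Longrightarrow> m = 0"
proof (cases "t \<ge> 0")
  case True
  moreover have "real_of_int \<lfloor>t\<rfloor> \<ge> 0" using True by simp
  moreover note floor_correct[of t]
  ultimately show ?thesis by (intro that[of "\<lfloor>t\<rfloor>"]; linarith)
next
  case False
  moreover have "real_of_int \<lfloor>- t\<rfloor> \<ge> 0" using False by simp
  moreover note floor_correct[of "- t"]
  ultimately show ?thesis by (intro that[of "- \<lfloor>- t\<rfloor>"]; linarith)
qed

text \<open>An error of at most \<open>h = 1 / (4 * sqrt k)\<close> in each of at most
  \<open>k\<close> coordinates has squared norm at most \<open>k * h^2 = 1 / 16\<close>. The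
  truncation of \<open>u / h\<close> has squared norm at most
  \<open>1 / h^2 = 16 * k\<close>.\<close>

lemma grid_approximation:
  fixes k d :: nat and u :: "nat \<Rightarrow> real"
  assumes T: "T \<subseteq> {..<d}" "card T \<le> k" and k: "k > 0"
    and u: "\<forall>i. i \<notin> T \<longrightarrow> u i = 0" and norm: "sq_norm d u = 1"
  obtains m where "m \<in> l1_int_ball d (16 * k)"
    "\<forall>i. i \<notin> T \<longrightarrow> m i = 0"
    "sq_norm d (\<lambda>i. real_of_int (m i) / (4 * sqrt (real k))) \<le> 1"
    "sq_norm d (\<lambda>i. u i - real_of_int (m i) / (4 * sqrt (real k))) \<le> 1 / 16"
proof -
  define h where "h = 1 / (4 * sqrt (real k))"
  have h: "h > 0" and h2: "real k * h\<^sup>2 = 1 / 16"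
    using k by (auto simp: h_def power_divide power_mult_distrib)
  have "\<exists>m::int. \<bar>real_of_int m\<bar> \<le> \<bar>u i / h\<bar> \<and> \<bar>u i / h - real_of_int m\<bar> \<le> 1 \<and> (u i / h = 0 \<longrightarrow> m = 0)" for i
    by (rule truncate_int[of "u i / h"]) blast
  then obtain m :: "nat \<Rightarrow> int" where m: "\<And>i. \<bar>real_of_int (m i)\<bar> \<le> \<bar>u i / h\<bar>"
    "\<And>i. \<bar>u i / h - real_of_int (m i)\<bar> \<le> 1" "\<And>i. u i / h = 0 \<Longrightarrow> m i = 0"
    by metis
  have m0: "m i = 0" if "i \<notin> T" for i using m(3) u that by simp
  have m_sq: "(real_of_int (m i))\<^sup>2 \<le> (u i / h)\<^sup>2" for i
    using m(1)[of i] by (metis abs_le_square_iff)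
  \<comment> \<open>For integers the absolute value is at most the square, so the bound
    \<open>16 * k\<close> on the squared norm also bounds the l1 norm, independently of
    \<open>d\<close>.\<close>
  have l1: "\<bar>m i\<bar> \<le> (m i)\<^sup>2" for i
  proof (cases "m i = 0")
    case False
    then have "\<bar>m i\<bar> * 1 \<le> \<bar>m i\<bar> * \<bar>m i\<bar>" by (intro mult_left_mono) auto
    then show ?thesis by (simp add: power2_eq_square abs_mult flip: abs_mult)
  qed auto
  have "real_of_int (\<Sum>i<d. \<bar>m i\<bar>) \<le> real_of_int (\<Sum>i<d. (m i)\<^sup>2)"
    unfolding of_int_le_iff by (intro sum_mono l1)
  also have "\<dots> \<le> (\<Sum>i<d. (u i / h)\<^sup>2)" using m_sq by (simp add: sum_mono)
  also have "\<dots> = sq_norm d u / h\<^sup>2" by (simp add: sq_norm_def power_divide sum_divide_distrib)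
  also have "\<dots> = 16 * real k"
  proof -
    have "1 = 16 * real k * h\<^sup>2" using h2 by simp
    then show ?thesis using h norm by (metis nonzero_mult_div_cancel_right less_irrefl power_not_zero)
  qed
  finally have "(\<Sum>i<d. \<bar>m i\<bar>) \<le> int (16 * k)" by linarith
  then have ball: "m \<in> l1_int_ball d (16 * k)"
    using m0 T(1) unfolding l1_int_ball_def by fastforce
  have "sq_norm d (\<lambda>i. real_of_int (m i) * h) \<le> sq_norm d u"
    unfolding sq_norm_def
  proof (rule sum_mono)
    fix i
    have "(real_of_int (m i))\<^sup>2 * h\<^sup>2 \<le> (u i / h)\<^sup>2 * h\<^sup>2"
      by (intro mult_right_mono m_sq) auto
    then show "(real_of_int (m i) * h)\<^sup>2 \<le> (u i)\<^sup>2"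
      using h by (simp add: power_mult_distrib power_divide)
  qed
  then have w1: "sq_norm d (\<lambda>i. real_of_int (m i) * h) \<le> 1" using norm by simp
  have "sq_norm d (\<lambda>i. u i - real_of_int (m i) * h) = (\<Sum>i\<in>T. (u i - real_of_int (m i) * h)\<^sup>2)"
    unfolding sq_norm_def using T u m0 by (intro sum.mono_neutral_right) auto
  also have "\<dots> \<le> (\<Sum>i\<in>T. h\<^sup>2)"
  proof (rule sum_mono)
    fix i
    have "\<bar>u i / h - real_of_int (m i)\<bar> * h \<le> 1 * h" using m(2) h by (intro mult_right_mono) auto
    moreover have "\<bar>u i / h - real_of_int (m i)\<bar> * h = \<bar>u i - real_of_int (m i) * h\<bar>"
    proof -
      have "\<bar>u i / h - real_of_int (m i)\<bar> * h = \<bar>(u i / h - real_of_int (m i)) * h\<bar>"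
        using h by (simp add: abs_mult)
      then show ?thesis using h by (simp add: left_diff_distrib)
    qed
    ultimately have "\<bar>u i - real_of_int (m i) * h\<bar> \<le> \<bar>h\<bar>" using h by simp
    then show "(u i - real_of_int (m i) * h)\<^sup>2 \<le> h\<^sup>2" by (simp only: abs_le_square_iff)
  qed
  also have "\<dots> \<le> real k * h\<^sup>2" using T by (auto intro: mult_right_mono)
  finally have "sq_norm d (\<lambda>i. u i - real_of_int (m i) * h) \<le> 1 / 16" using h2 by simp
  then show ?thesis using that[OF ball] m0 w1 by (simp add: h_def)
qed

text \<open>
  If S is the supremum of the form over the unit sphere of the coordinate subspace of T, then
  polarization inside this subspace bounds the error of replacing a unit vector by its grid point
  by S / 2, hence S is at most delta + S / 2.
\<close>
lemma bilin_le_on_grid: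
  fixes k d :: nat and u :: "nat \<Rightarrow> real"
  assumes sym: "\<And>i j. i < d \<Longrightarrow> j < d \<Longrightarrow> E i j = E j i"
    and grid: "\<And>m w. m \<in> l1_int_ball d (16 * k) \<Longrightarrow> w = (\<lambda>i. real_of_int (m i) / (4 * sqrt (real k)))
        \<Longrightarrow> sq_norm d w \<le> 1 \<Longrightarrow> \<bar>bilin d E w w\<bar> \<le> \<delta>"
    and T: "T \<subseteq> {..<d}" "card T \<le> k" and k: "k > 0"
    and u: "\<forall>i. i \<notin> T \<longrightarrow> u i = 0" and norm: "sq_norm d u = 1"
  shows "\<bar>bilin d E u u\<bar> \<le> 2 * \<delta>"
proof -
  define V where "V = {x. (\<forall>i. i \<notin> T \<longrightarrow> x i = 0) \<and> sq_norm d x = 1}"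
  define S where "S = (SUP x\<in>V. \<bar>bilin d E x x\<bar>)"
  have bdd: "bdd_above ((\<lambda>x. \<bar>bilin d E x x\<bar>) ` V)"
    using bilin_bounded by (intro bdd_aboveI2[of _ _ "\<Sum>i<d. \<Sum>j<d. \<bar>E i j\<bar>"]) (auto simp: V_def)
  have S_upper: "\<bar>bilin d E x x\<bar> \<le> S" if "\<forall>i. i \<notin> T \<longrightarrow> x i = 0" "sq_norm d x = 1" for x
    unfolding S_def using that by (intro cSUP_upper bdd) (auto simp: V_def)
  have uV: "u \<in> V" using u norm by (simp add: V_def)
  have S0: "S \<ge> 0" using S_upper[OF u norm] by linarith
  have "\<bar>bilin d E x x\<bar> \<le> \<delta> + S / 2" if "x \<in> V" for x
  proof -
    have x: "\<forall>i. i \<notin> T \<longrightarrow> x i = 0" "sq_norm d x = 1" using that by (auto simp: V_def)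
    obtain m where m: "m \<in> l1_int_ball d (16 * k)" "\<forall>i. i \<notin> T \<longrightarrow> m i = 0"
      "sq_norm d (\<lambda>i. real_of_int (m i) / (4 * sqrt (real k))) \<le> 1"
      "sq_norm d (\<lambda>i. x i - real_of_int (m i) / (4 * sqrt (real k))) \<le> 1 / 16"
      by (rule grid_approximation[OF T k x])
    define w where "w = (\<lambda>i. real_of_int (m i) / (4 * sqrt (real k)))"
    have w: "\<forall>i. i \<notin> T \<longrightarrow> w i = 0" "sq_norm d w \<le> 1" "sq_norm d (\<lambda>i. x i - w i) \<le> 1 / 16"
      using m by (simp_all add: w_def)
    let ?a = "\<lambda>i. x i - w i" and ?b = "\<lambda>i. x i + w i"
    \<comment> \<open>The factor 8 balances the arguments: \<open>8 * ?a\<close> and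
      \<open>?b\<close> both have squared norm at most 4. Without it polarization would give an
      error of about \<open>2 * S\<close>, too large to absorb.\<close>
    have "2 * \<bar>bilin d E (\<lambda>i. 8 * ?a i) ?b\<bar> \<le> S * (sq_norm d (\<lambda>i. 8 * ?a i) + sq_norm d ?b)"
      using x w by (intro bilin_polarization_le[where T = T] sym S_upper) auto
    also have "\<dots> \<le> S * (4 + 4)"
    proof (intro mult_left_mono add_mono S0)
      show "sq_norm d (\<lambda>i. 8 * ?a i) \<le> 4" using w(3) unfolding sq_norm_scale[of d 8 ?a] by simp
      show "sq_norm d ?b \<le> 4"
        using parallelogram[of d x w] sq_norm_nonneg[of d ?a] w(2) x(2) by simp
    qed
    finally have "\<bar>bilin d E ?a ?b\<bar> \<le> S / 2" unfolding bilin_scale_left[of d E 8 ?a] by (simp add: abs_mult)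
    \<comment> \<open>Symmetry turns the form at \<open>(x - w, x + w)\<close> into a difference of
      squares.\<close>
    moreover have "bilin d E x w = bilin d E w x" using sym by (rule bilin_commute)
    then have "bilin d E ?a ?b = bilin d E x x - bilin d E w w"
      by (simp add: bilin_diff_left bilin_add_right)
    moreover have "\<bar>bilin d E w w\<bar> \<le> \<delta>" using grid[OF m(1) w_def w(2)] .
    ultimately show ?thesis by linarith
  qed
  then have "S \<le> \<delta> + S / 2" unfolding S_def using uV by (intro cSUP_least) auto
  then show ?thesis using S_upper[OF u norm] by linarith
qed

section \<open>Compactness and measurability\<close>

text \<open>
  By compactness of C, the event is a union over rational thresholds r that separate the values on
  C from some value on F; both conditions can be tested on countable dense subsets.
\<close>
lemma beaten_event_sets:
  fixes F C :: "'b :: {metric_space, second_countable_topology} set"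
    and f :: "'a \<Rightarrow> 'b \<Rightarrow> real"
  assumes C: "compact C"
    and cont: "\<And>\<omega>. continuous_on UNIV (f \<omega>)"
    and meas[measurable]: "\<And>x. (\<lambda>\<omega>. f \<omega> x) \<in> borel_measurable M"
  shows "{\<omega> \<in> space M. \<forall>x\<in>C. \<exists>y\<in>F. f \<omega> x < f \<omega> y} \<in> sets M"
proof (cases "C = {}")
  case False
  obtain DC where DC: "countable DC" "DC \<subseteq> C" "C \<subseteq> closure DC" by (rule separable)
  obtain DF where DF: "countable DF" "DF \<subseteq> F" "F \<subseteq> closure DF" by (rule separable)
  have "(\<forall>x\<in>C. \<exists>y\<in>F. f \<omega> x < f \<omega> y) \<longleftrightarrow>
      (\<exists>r\<in>\<rat>. (\<forall>x\<in>DC. f \<omega> x \<le> r) \<and> (\<exists>y\<in>DF. r < f \<omega> y))" for \<omega>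
  proof
    assume *: "\<forall>x\<in>C. \<exists>y\<in>F. f \<omega> x < f \<omega> y"
    have "\<exists>x\<in>C. \<forall>x'\<in>C. f \<omega> x' \<le> f \<omega> x"
      using C False continuous_on_subset[OF cont] by (intro continuous_attains_sup) auto
    then obtain x where x: "x \<in> C" "\<And>x'. x' \<in> C \<Longrightarrow> f \<omega> x' \<le> f \<omega> x" by blast
    obtain y where y: "y \<in> F" "f \<omega> x < f \<omega> y" using * x by blast
    obtain r where r: "r \<in> \<rat>" "f \<omega> x < r" "r < f \<omega> y" using Rats_dense_in_real[OF y(2)] by blast
    have "open {z. r < f \<omega> z}"
      by (intro open_Collect_less continuous_intros cont)
    moreover have "y \<in> {z. r < f \<omega> z} \<inter> closure DF" using r y DF by auto
    ultimately have "{z. r < f \<omega> z} \<inter> DF \<noteq> {}"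
      using open_Int_closure_eq_empty by blast
    then show "\<exists>r\<in>\<rat>. (\<forall>x\<in>DC. f \<omega> x \<le> r) \<and> (\<exists>y\<in>DF. r < f \<omega> y)"
      using r x DC(2) by (intro bexI[of _ r]) force+
  next
    assume "\<exists>r\<in>\<rat>. (\<forall>x\<in>DC. f \<omega> x \<le> r) \<and> (\<exists>y\<in>DF. r < f \<omega> y)"
    then obtain r y where r: "\<forall>x\<in>DC. f \<omega> x \<le> r" "y \<in> DF" "r < f \<omega> y" by blast
    have "closed {z. f \<omega> z \<le> r}"
      by (intro closed_Collect_le continuous_intros cont)
    then have "closure DC \<subseteq> {z. f \<omega> z \<le> r}" using r by (intro closure_minimal) auto
    then show "\<forall>x\<in>C. \<exists>y\<in>F. f \<omega> x < f \<omega> y" using DC DF r by force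
  qed
  then have "{\<omega> \<in> space M. \<forall>x\<in>C. \<exists>y\<in>F. f \<omega> x < f \<omega> y} =
      (\<Union>r\<in>\<rat>. {\<omega> \<in> space M. (\<forall>x\<in>DC. f \<omega> x \<le> r) \<and> (\<exists>y\<in>DF. r < f \<omega> y)})"
    by auto
  also have "\<dots> \<in> sets M"
  proof (rule sets.countable_UN'[OF countable_rat], safe)
    fix r
    have "space M - (\<Union>x\<in>DC. {\<omega> \<in> space M. r < f \<omega> x}) \<in> sets M"
      by (intro sets.Diff sets.top sets.countable_UN' DC(1) image_subsetI) measurable
    also have "space M - (\<Union>x\<in>DC. {\<omega> \<in> space M. r < f \<omega> x})
        = {\<omega> \<in> space M. \<forall>x\<in>DC. f \<omega> x \<le> r}" by (auto simp: not_less)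
    finally have "{\<omega> \<in> space M. \<forall>x\<in>DC. f \<omega> x \<le> r} \<in> sets M" .
    moreover have "(\<Union>y\<in>DF. {\<omega> \<in> space M. r < f \<omega> y}) \<in> sets M"
      by (intro sets.countable_UN' DF(1) image_subsetI) measurable
    then have "{\<omega> \<in> space M. \<exists>y\<in>DF. r < f \<omega> y} \<in> sets M"
      by (rule back_subst[of "\<lambda>S. S \<in> sets M"]) auto
    ultimately show "{\<omega> \<in> space M. (\<forall>x\<in>DC. f \<omega> x \<le> r) \<and> (\<exists>y\<in>DF. r < f \<omega> y)} \<in> sets M"
      by (simp add: sets.sets_Collect_conj)
  qed
  finally show ?thesis .
qed auto

section \<open>The sparse unit sphere in the product topology\<close>

definition sparse_fun :: "nat \<Rightarrow> nat \<Rightarrow> (nat \<Rightarrow> real) set" where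
  "sparse_fun k d = {x. (\<forall>i\<ge>d. x i = 0) \<and> sq_norm d x = 1 \<and> card {i. i < d \<and> x i \<noteq> 0} \<le> k}"

lemma continuous_on_bilin: "continuous_on S (\<lambda>x. bilin d E x x)"
  unfolding bilin_def by (intro continuous_intros continuous_on_subset[OF continuous_on_product_coordinates]) auto

lemma continuous_on_sq_norm: "continuous_on S (sq_norm d)"
  unfolding sq_norm_def[abs_def]
  by (intro continuous_intros continuous_on_subset[OF continuous_on_product_coordinates]) auto

lemma closed_coord_zero: "closed {x :: nat \<Rightarrow> real. x i = 0}"
  by (intro closed_Collect_eq continuous_intros continuous_on_product_coordinates)

lemma compact_sparse_fun: "compact (sparse_fun k d)"
proof -
  let ?\<S> = "{S. S \<subseteq> {..<d} \<and> card S \<le> k}"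
  have finS: "finite ?\<S>" by simp
  \<comment> \<open>The number of nonzero entries is not continuous; sparsity is therefore expressed
    as membership in one of finitely many coordinate subspaces, each of them closed.\<close>
  have sparse: "card {i. i < d \<and> x i \<noteq> 0} \<le> k \<longleftrightarrow> (\<exists>S\<in>?\<S>. \<forall>i\<in>{..<d} - S. x i = 0)"
    for x :: "nat \<Rightarrow> real"
  proof
    assume "card {i. i < d \<and> x i \<noteq> 0} \<le> k"
    then show "\<exists>S\<in>?\<S>. \<forall>i\<in>{..<d} - S. x i = 0"
      by (intro bexI[of _ "{i. i < d \<and> x i \<noteq> 0}"]) auto
  next
    assume "\<exists>S\<in>?\<S>. \<forall>i\<in>{..<d} - S. x i = 0"
    then obtain S where S: "S \<subseteq> {..<d}" "card S \<le> k" "\<forall>i\<in>{..<d} - S. x i = 0" by blast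
    have "card {i. i < d \<and> x i \<noteq> 0} \<le> card S"
      using S finite_subset[OF S(1)] by (intro card_mono) auto
    then show "card {i. i < d \<and> x i \<noteq> 0} \<le> k" using S by simp
  qed
  have eq: "sparse_fun k d = (\<Inter>i\<in>{d..}. {x. x i = 0}) \<inter> {x. sq_norm d x = 1} \<inter>
      (\<Union>S\<in>?\<S>. \<Inter>i\<in>{..<d} - S. {x. x i = 0})"
    unfolding sparse_fun_def sparse by auto
  have closed: "closed (sparse_fun k d)"
    unfolding eq
    by (intro closed_Int closed_INT closed_UN finS ballI closed_coord_zero closed_Collect_eq
        continuous_on_sq_norm continuous_intros)
  \<comment> \<open>Tychonoff's theorem for the cube: unit norm puts the coordinates below
    \<open>d\<close> into \<open>[-1, 1]\<close>, and the others are zero.\<close>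
  have "compactin (product_topology (\<lambda>_. euclidean) UNIV) (PiE UNIV (\<lambda>_::nat. {-1..1::real}))"
    unfolding compactin_PiE by auto
  then have "compact (PiE UNIV (\<lambda>_::nat. {-1..1::real}))"
    by (simp add: euclidean_product_topology)
  moreover have "sparse_fun k d \<subseteq> PiE UNIV (\<lambda>_. {-1..1})"
  proof
    fix x assume x: "x \<in> sparse_fun k d"
    have "\<bar>x i\<bar> \<le> 1" for i
      using x coord_le_1[of d x i] by (cases "i < d") (auto simp: sparse_fun_def)
    then show "x \<in> PiE UNIV (\<lambda>_. {-1..1})" by (auto simp: abs_le_iff minus_le_iff)
  qed
  ultimately show ?thesis using compact_Int_closed[OF _ closed] by (metis inf.absorb2)
qed

section \<open>Passage between vectors, matrices and coordinate functions\<close>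

lemma sparse_unit_eq: "sparse_unit k d = vec d ` sparse_fun k d"
proof (intro equalityI subsetI)
  fix u assume u: "u \<in> sparse_unit k d"
  let ?x = "\<lambda>i. if i < d then u $ i else 0"
  have dim: "dim_vec u = d" using u by (auto simp: sparse_unit_def)
  have "{i. i < d \<and> ?x i \<noteq> 0} = {i. i < d \<and> u $ i \<noteq> 0}" by auto
  then have "?x \<in> sparse_fun k d"
    using u dim by (auto simp: sparse_unit_def sparse_fun_def l2_norm_def l0_norm_def sq_norm_def)
  moreover have "u = vec d ?x" using dim by auto
  ultimately show "u \<in> vec d ` sparse_fun k d" by blast
next
  fix u assume "u \<in> vec d ` sparse_fun k d"
  then obtain x where x: "x \<in> sparse_fun k d" "u = vec d x" by blast
  have "{i. i < d \<and> vec d x $ i \<noteq> 0} = {i. i < d \<and> x i \<noteq> 0}" by auto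
  then show "u \<in> sparse_unit k d"
    using x by (simp add: sparse_unit_def sparse_fun_def l2_norm_def l0_norm_def sq_norm_def)
qed

lemma quadratic_form_vec:
  assumes "Y \<in> carrier_mat d d"
  shows "vec d x \<bullet> (Y *\<^sub>v vec d x) = bilin d (\<lambda>i j. Y $$ (i, j)) x x"
  using assms by (auto simp: scalar_prod_def bilin_def sum_distrib_left mult_ac atLeast0LessThan
      intro!: sum.cong)

lemma mat_inner_outer_vec:
  assumes "Y \<in> carrier_mat d d"
  shows "mat_inner Y (outer (vec d x)) = bilin d (\<lambda>i j. Y $$ (i, j)) x x"
  using assms by (auto simp: mat_inner_def outer_def bilin_def mult_ac intro!: sum.cong)

lemma mat_inner_outer:
  assumes "Y \<in> carrier_mat d d" "u \<in> carrier_vec d"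
  shows "mat_inner Y (outer u) = u \<bullet> (Y *\<^sub>v u)"
proof -
  have "u = vec d (\<lambda>i. u $ i)" using assms(2) by auto
  then show ?thesis
    using quadratic_form_vec[OF assms(1), of "\<lambda>i. u $ i"]
      mat_inner_outer_vec[OF assms(1), of "\<lambda>i. u $ i"] by simp
qed

text \<open>After expanding the squares, each double sum factors into a product of single sums.
  Stated for vectors of any norm, the formula also shows that the distance depends continuously on
  \<open>x\<close>.\<close>

lemma frobenius_norm_outer_diff:
  "frobenius_norm (outer (vec d x) - outer (vec d a))
     = sqrt ((sq_norm d x)\<^sup>2 - 2 * (\<Sum>i<d. x i * a i)\<^sup>2 + (sq_norm d a)\<^sup>2)"
proof -
  have "mat_inner (outer (vec d x) - outer (vec d a)) (outer (vec d x) - outer (vec d a))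
      = (\<Sum>i<d. \<Sum>j<d. (x i * x j - a i * a j)\<^sup>2)"
    by (simp add: mat_inner_def outer_def power2_eq_square)
  also have "\<dots> = (\<Sum>i<d. \<Sum>j<d. (x i)\<^sup>2 * (x j)\<^sup>2)
      - 2 * (\<Sum>i<d. \<Sum>j<d. (x i * a i) * (x j * a j)) + (\<Sum>i<d. \<Sum>j<d. (a i)\<^sup>2 * (a j)\<^sup>2)"
    by (simp add: power2_eq_square algebra_simps sum.distrib sum_subtractf sum_distrib_left)
  also have "\<dots> = (sq_norm d x)\<^sup>2 - 2 * (\<Sum>i<d. x i * a i)\<^sup>2 + (sq_norm d a)\<^sup>2"
    by (simp only: sum_product[symmetric] sq_norm_def power2_eq_square[of "sum _ _"])
  finally show ?thesis by (simp add: frobenius_norm_def)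
qed

lemma solves_vector_vec_iff:
  assumes "Y \<in> carrier_mat d d"
  shows "solves_vector k d Y u \<longleftrightarrow> (\<exists>x\<in>sparse_fun k d. u = vec d x \<and>
    (\<forall>x'\<in>sparse_fun k d. bilin d (\<lambda>i j. Y $$ (i, j)) x' x' \<le> bilin d (\<lambda>i j. Y $$ (i, j)) x x))"
  unfolding solves_vector_def is_arg_max_def sparse_unit_eq
  by (auto simp: quadratic_form_vec[OF assms] not_less)

text \<open>The objectives agree along \<open>outer\<close>, so the matrix problem reduces to the
  vector problem.\<close>

lemma solves_matrix_iff:
  assumes "Y \<in> carrier_mat d d"
  shows "solves_matrix k d Y B \<longleftrightarrow> (\<exists>u. solves_vector k d Y u \<and> B = outer u)"
proof -
  have "mat_inner Y (outer u) = u \<bullet> (Y *\<^sub>v u)" if "u \<in> sparse_unit k d" for u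
    using assms that by (intro mat_inner_outer) (auto simp: sparse_unit_def)
  then show ?thesis
    unfolding solves_matrix_def solves_vector_def is_arg_max_def alphabet_def by auto
qed

text \<open>A continuous form attains its maximum on a compact set. This keeps statements about all
  maximizers from being vacuous.\<close>

lemma solves_vector_exists:
  assumes "Y \<in> carrier_mat d d" "sparse_fun k d \<noteq> {}"
  shows "\<exists>u. solves_vector k d Y u"
  using continuous_attains_sup[OF compact_sparse_fun assms(2) continuous_on_bilin]
  unfolding solves_vector_vec_iff[OF assms(1)] by blast

section \<open>Concentration and recovery\<close>

definition spiked_form :: "real \<Rightarrow> (nat \<Rightarrow> real) \<Rightarrow> nat \<Rightarrow> nat \<Rightarrow> real" where
  "spiked_form \<theta> a i j = a i * a j + (if i = j then \<theta> else 0)"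

lemma bilin_spiked_form: "bilin d (spiked_form \<theta> a) x x = (\<Sum>i<d. x i * a i)\<^sup>2 + \<theta> * sq_norm d x"
proof -
  have "bilin d (spiked_form \<theta> a) x x = (\<Sum>i<d. \<Sum>j<d. (x i * a i) * (x j * a j))
      + (\<Sum>i<d. \<Sum>j<d. if i = j then \<theta> * (x i * x i) else 0)"
    unfolding bilin_def spiked_form_def sum.distrib[symmetric]
    by (intro sum.cong) (auto simp: algebra_simps)
  also have "(\<Sum>i<d. \<Sum>j<d. if i = j then \<theta> * (x i * x i) else 0) = (\<Sum>i<d. \<theta> * (x i * x i))"
    by (intro sum.cong) auto
  also have "\<dots> = \<theta> * sq_norm d x" by (simp add: sq_norm_def power2_eq_square sum_distrib_left)
  also have "(\<Sum>i<d. \<Sum>j<d. (x i * a i) * (x j * a j)) = (\<Sum>i<d. x i * a i)\<^sup>2"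
    by (simp only: sum_product power2_eq_square)
  finally show ?thesis .
qed

text \<open>The form at a grid point is the variance of the corresponding functional of a sample,
  and the tail bound wants it between 0 and 2. Cauchy-Schwarz bounds the spike part by 1, and the
  noise part is at most \<open>\<theta>\<close>.\<close>

lemma spiked_form_bounds:
  assumes "0 \<le> \<theta>" "\<theta> \<le> 1" "sq_norm d a \<le> 1" "sq_norm d x \<le> 1"
  shows "0 \<le> bilin d (spiked_form \<theta> a) x x" "bilin d (spiked_form \<theta> a) x x \<le> 2"
proof -
  have "(\<Sum>i<d. x i * a i)\<^sup>2 \<le> sq_norm d x * sq_norm d a"
    unfolding sq_norm_def by (rule Cauchy_Schwarz_ineq_sum)
  also have "\<dots> \<le> 1 * 1" using assms by (intro mult_mono) (auto simp: sq_norm_nonneg)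
  finally have "(\<Sum>i<d. x i * a i)\<^sup>2 \<le> 1" by simp
  moreover have "\<theta> * sq_norm d x \<le> 1 * 1"
    using assms by (intro mult_mono) (auto simp: sq_norm_nonneg)
  ultimately show "bilin d (spiked_form \<theta> a) x x \<le> 2" by (simp add: bilin_spiked_form)
qed (use assms in \<open>simp add: bilin_spiked_form sq_norm_nonneg\<close>)

lemma spiked_cov_index:
  assumes "i < d" "j < d"
  shows "spiked_cov d \<theta> (outer (vec d a)) $$ (i, j) = spiked_form \<theta> a i j"
  using assms by (auto simp: spiked_cov_def outer_def spiked_form_def)

section \<open>Linear functionals of the samples and the mean of their squares\<close>

lemma measurable_vec_borel_index:
  assumes "i < d"
  shows "(\<lambda>v. v $ i) \<in> borel_measurable (vec_borel d)"
proof -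
  have "(\<lambda>v. \<lambda>i\<in>{..<d}. v $ i) \<in> carrier_vec d \<rightarrow> space (\<Pi>\<^sub>M i\<in>{..<d}. borel)"
    by (auto simp: space_PiM)
  then have "(\<lambda>v. \<lambda>i\<in>{..<d}. v $ i) \<in> vec_borel d \<rightarrow>\<^sub>M (\<Pi>\<^sub>M i\<in>{..<d}. borel)"
    unfolding vec_borel_def by (rule measurable_vimage_algebra1)
  from measurable_compose[OF this measurable_component_singleton] assms
  have "(\<lambda>v. (\<lambda>i\<in>{..<d}. v $ i) i) \<in> borel_measurable (vec_borel d)"
    by fast
  then show ?thesis using assms by simp
qed

lemma space_vec_borel: "space (vec_borel d) = carrier_vec d"
  by (simp add: vec_borel_def)

lemma scalar_prod_vec:
  assumes "v \<in> carrier_vec d"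
  shows "vec d w \<bullet> v = (\<Sum>i<d. w i * v $ i)"
proof -
  have "dim_vec v = d" using assms by (rule carrier_vecD)
  then show ?thesis by (simp add: scalar_prod_def atLeast0LessThan)
qed

lemma measurable_vec_borel_scalar_prod:
  "(\<lambda>v. vec d w \<bullet> v) \<in> borel_measurable (vec_borel d)"
proof -
  have "(\<lambda>v. \<Sum>i<d. w i * v $ i) \<in> borel_measurable (vec_borel d)"
    by (intro borel_measurable_sum borel_measurable_times measurable_vec_borel_index) auto
  moreover have "(\<lambda>v. vec d w \<bullet> v) \<in> borel_measurable (vec_borel d)
      \<longleftrightarrow> (\<lambda>v. \<Sum>i<d. w i * v $ i) \<in> borel_measurable (vec_borel d)"
    by (intro measurable_cong) (simp add: scalar_prod_vec space_vec_borel)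
  ultimately show ?thesis by blast
qed

lemma sample_cov_carrier [simp]: "sample_cov d n z \<in> carrier_mat d d"
  by (simp add: sample_cov_def)

lemma sample_cov_index:
  assumes "\<And>i. i < n \<Longrightarrow> z i \<in> carrier_vec d" "a < d" "b < d"
  shows "sample_cov d n z $$ (a, b) = (\<Sum>i<n. z i $ a * z i $ b) / real n"
proof -
  have "outer (z i) $$ (a, b) = z i $ a * z i $ b" if "i < n" for i
    using carrier_vecD[OF assms(1)[OF that]] assms(2,3) by (simp add: outer_def)
  then have "(\<Sum>i<n. outer (z i) $$ (a, b)) = (\<Sum>i<n. z i $ a * z i $ b)"
    by (intro sum.cong) auto
  then show ?thesis using assms(2,3) by (simp add: sample_cov_def)
qed

text \<open>Interchanging the sums gives the mean of squares to which the Gaussian tail bound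
  applies.\<close>

lemma bilin_sample_cov:
  assumes "\<And>i. i < n \<Longrightarrow> z i \<in> carrier_vec d"
  shows "bilin d (\<lambda>a b. sample_cov d n z $$ (a, b)) w w = (\<Sum>i<n. (vec d w \<bullet> z i)\<^sup>2) / real n"
proof -
  let ?p = "\<lambda>i a b. (w a * z i $ a) * (w b * z i $ b)"
  have entry: "sample_cov d n z $$ (a, b) * w a * w b = (\<Sum>i<n. ?p i a b) / real n"
    if "a < d" "b < d" for a b
  proof -
    have "(\<Sum>i<n. ?p i a b) = (\<Sum>i<n. z i $ a * z i $ b) * (w a * w b)"
      unfolding sum_distrib_right by (intro sum.cong refl) (simp only: mult_ac)
    moreover have "sample_cov d n z $$ (a, b) = (\<Sum>i<n. z i $ a * z i $ b) / real n"
      using assms that by (rule sample_cov_index)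
    ultimately show ?thesis by (simp only: times_divide_eq_left mult.assoc)
  qed
  have "bilin d (\<lambda>a b. sample_cov d n z $$ (a, b)) w w = (\<Sum>a<d. \<Sum>b<d. (\<Sum>i<n. ?p i a b) / real n)"
    unfolding bilin_def by (intro sum.cong refl entry) auto
  also have "\<dots> = (\<Sum>a<d. \<Sum>b<d. \<Sum>i<n. ?p i a b) / real n"
    by (simp only: sum_divide_distrib[symmetric])
  also have "(\<Sum>a<d. \<Sum>b<d. \<Sum>i<n. ?p i a b) = (\<Sum>a<d. \<Sum>i<n. \<Sum>b<d. ?p i a b)"
    by (rule sum.cong[OF refl]) (rule sum.swap)
  also have "\<dots> = (\<Sum>i<n. \<Sum>a<d. \<Sum>b<d. ?p i a b)" by (rule sum.swap)
  also have "\<dots> = (\<Sum>i<n. (vec d w \<bullet> z i)\<^sup>2)"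
  proof (rule sum.cong)
    fix i assume "i \<in> {..<n}"
    then have "vec d w \<bullet> z i = (\<Sum>a<d. w a * z i $ a)"
      using assms by (intro scalar_prod_vec) auto
    then show "(\<Sum>a<d. \<Sum>b<d. (w a * z i $ a) * (w b * z i $ b)) = (vec d w \<bullet> z i)\<^sup>2"
      by (simp only: sum_product power2_eq_square)
  qed simp
  finally show ?thesis .
qed

section \<open>Uniform deviation over sparse unit vectors\<close>

lemma bilin_diff_form: "bilin d (\<lambda>i j. E i j - E' i j) x y = bilin d E x y - bilin d E' x y"
  by (simp add: bilin_def left_diff_distrib sum_subtractf)

lemma sparse_fun_pos:
  assumes "a \<in> sparse_fun k d"
  shows "k > 0" "d > 0"
proof -
  have "sq_norm d a \<noteq> 0" using assms by (simp add: sparse_fun_def)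
  then obtain i where i: "i < d" "a i \<noteq> 0" by (auto simp: sq_norm_eq_0_iff)
  then have "card {i. i < d \<and> a i \<noteq> 0} > 0" by (auto simp: card_gt_0_iff)
  then show "k > 0" using assms by (auto simp: sparse_fun_def)
  show "d > 0" using i by auto
qed

text \<open>The exceptional event \<open>B\<close> is the finite union of the deviation events of
  the grid points. Off \<open>B\<close>, the difference of the sample and population forms is at
  most \<open>\<delta>\<close> on the grid, hence at most \<open>2 * \<delta>\<close> on all sparse
  unit vectors.\<close>

lemma (in prob_space) sample_cov_concentration:
  fixes z :: "nat \<Rightarrow> 'a \<Rightarrow> real vec"
  assumes \<theta>: "0 \<le> \<theta>" "\<theta> < 1" and a: "a \<in> sparse_fun k d"
    and normal: "\<And>i. i < n \<Longrightarrow>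
          normal_vec M d (0\<^sub>v d) (spiked_cov d \<theta> (outer (vec d a))) (z i)"
    and indep: "indep_vars (\<lambda>_. vec_borel d) z {..<n}"
    and n: "n > 0" and \<delta>: "0 < \<delta>" "\<delta> \<le> 1"
  obtains B where "B \<in> events"
    "prob B \<le> 2 * real ((2 * d + 1) ^ (16 * k)) * exp (- (real n * \<delta>\<^sup>2 / 64))"
    "\<forall>\<omega>\<in>space M - B. \<forall>x\<in>sparse_fun k d.
       \<bar>bilin d (\<lambda>i j. sample_cov d n (\<lambda>i. z i \<omega>) $$ (i, j)) x x - bilin d (spiked_form \<theta> a) x x\<bar> \<le> 2 * \<delta>"
proof -
  let ?S = "spiked_form \<theta> a"
  have z: "z i \<in> measurable M (vec_borel d)" if "i < n" for i
    using normal[OF that] by (simp add: normal_vec_def)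
  have zc: "z i \<omega> \<in> carrier_vec d" if "i < n" "\<omega> \<in> space M" for i \<omega>
    using measurable_space[OF z] that by (simp add: space_vec_borel)
  have a1: "sq_norm d a \<le> 1" using a by (simp add: sparse_fun_def)
  define w where "w m = (\<lambda>i. real_of_int (m i) / (4 * sqrt (real k)))" for m :: "nat \<Rightarrow> int"
  \<comment> \<open>Only grid points of norm at most 1 are kept, so that their variances are at most
    2.\<close>
  define N where "N = {m \<in> l1_int_ball d (16 * k). sq_norm d (w m) \<le> 1}"
  have finN: "finite N" using card_l1_int_ball by (simp add: N_def)
  have cardN: "card N \<le> (2 * d + 1) ^ (16 * k)"
    using card_l1_int_ball[of d "16 * k"] card_mono[of "l1_int_ball d (16 * k)" N]
    by (auto simp: N_def)
  define X where "X m i \<omega> = vec d (w m) \<bullet> z i \<omega>" for m i \<omega>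
  define D where "D m = {\<omega> \<in> space M. \<bar>(\<Sum>i<n. (X m i \<omega>)\<^sup>2) / real n - bilin d ?S (w m) (w m)\<bar> > \<delta>}" for m
  have X_meas[measurable]: "random_variable borel (X m i)" if "i < n" for m i
    unfolding X_def using measurable_compose[OF z[OF that] measurable_vec_borel_scalar_prod] .
  have D_events: "D m \<in> events" for m unfolding D_def by measurable
  have D_prob: "prob (D m) \<le> 2 * exp (- (real n * \<delta>\<^sup>2 / 64))" if "m \<in> N" for m
    unfolding D_def
  proof (rule mean_square_tail)
    show "indep_vars (\<lambda>_. borel) (X m) {..<n}"
      unfolding X_def using indep
      by (rule indep_vars_compose2) (rule measurable_vec_borel_scalar_prod)
    fix i assume i: "i < n"
    let ?S' = "spiked_cov d \<theta> (outer (vec d a))"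
    have "distr M borel (X m i) = normal_law (vec d (w m) \<bullet> 0\<^sub>v d) (vec d (w m) \<bullet> (?S' *\<^sub>v vec d (w m)))"
      unfolding X_def using normal[OF i] by (simp add: normal_vec_def)
    also have "vec d (w m) \<bullet> (?S' *\<^sub>v vec d (w m)) = bilin d (\<lambda>i j. ?S' $$ (i, j)) (w m) (w m)"
      by (intro quadratic_form_vec) (auto simp: spiked_cov_def outer_def)
    also have "\<dots> = bilin d ?S (w m) (w m)"
      unfolding bilin_def by (intro sum.cong) (auto simp: spiked_cov_index)
    finally show "distr M borel (X m i) = normal_law 0 (bilin d ?S (w m) (w m))" by simp
  qed (use that \<theta> a1 n \<delta> in \<open>auto intro!: spiked_form_bounds simp: N_def\<close>)
  define B where "B = (\<Union>m\<in>N. D m)"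
  show thesis
  proof (rule that[of B])
    show "B \<in> events" unfolding B_def using finN D_events by auto
    have "prob B \<le> (\<Sum>m\<in>N. prob (D m))"
      unfolding B_def using finN D_events by (intro finite_measure_subadditive_finite) auto
    also have "\<dots> \<le> (\<Sum>m\<in>N. 2 * exp (- (real n * \<delta>\<^sup>2 / 64)))" by (intro sum_mono D_prob)
    also have "\<dots> = real (card N) * (2 * exp (- (real n * \<delta>\<^sup>2 / 64)))" by simp
    also have "\<dots> \<le> real ((2 * d + 1) ^ (16 * k)) * (2 * exp (- (real n * \<delta>\<^sup>2 / 64)))"
      using cardN by (intro mult_right_mono) (auto simp del: of_nat_power)
    finally show "prob B \<le> 2 * real ((2 * d + 1) ^ (16 * k)) * exp (- (real n * \<delta>\<^sup>2 / 64))"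
      by (simp add: mult_ac)
  next
    show "\<forall>\<omega>\<in>space M - B. \<forall>x\<in>sparse_fun k d.
       \<bar>bilin d (\<lambda>i j. sample_cov d n (\<lambda>i. z i \<omega>) $$ (i, j)) x x - bilin d ?S x x\<bar> \<le> 2 * \<delta>"
    proof (intro ballI)
      fix \<omega> x assume \<omega>: "\<omega> \<in> space M - B" and x: "x \<in> sparse_fun k d"
      let ?Y = "\<lambda>i j. sample_cov d n (\<lambda>i. z i \<omega>) $$ (i, j)"
      \<comment> \<open>The subspace is that of the support of \<open>x\<close> and varies with
        \<open>x\<close>; the grid and \<open>B\<close> do not.\<close>
      have "\<bar>bilin d (\<lambda>i j. ?Y i j - ?S i j) x x\<bar> \<le> 2 * \<delta>"
      proof (rule bilin_le_on_grid[where T = "{i. i < d \<and> x i \<noteq> 0}"])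
        fix i j assume "i < d" "j < d"
        then show "?Y i j - ?S i j = ?Y j i - ?S j i"
          using \<omega> zc by (simp add: sample_cov_index spiked_form_def mult_ac)
      next
        fix m v assume m: "m \<in> l1_int_ball d (16 * k)" "v = (\<lambda>i. real_of_int (m i) / (4 * sqrt (real k)))"
          "sq_norm d v \<le> 1"
        then have "v = w m" "m \<in> N" by (auto simp: w_def N_def)
        then have "\<omega> \<notin> D m" using \<omega> by (auto simp: B_def)
        then show "\<bar>bilin d (\<lambda>i j. ?Y i j - ?S i j) v v\<bar> \<le> \<delta>"
          using \<omega> zc \<open>v = w m\<close> by (simp add: bilin_diff_form bilin_sample_cov D_def X_def)
      qed (use x sparse_fun_pos[OF a] in \<open>auto simp: sparse_fun_def not_less\<close>)
      then show "\<bar>bilin d ?Y x x - bilin d ?S x x\<bar> \<le> 2 * \<delta>" by (simp add: bilin_diff_form)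
    qed
  qed
qed

text \<open>With \<open>E\<close> for the sample form, \<open>(x . a)^2 + \<theta> \<ge> E(x) - 2
  \<delta> \<ge> E(a) - 2 \<delta> \<ge> 1 + \<theta> - 4 \<delta>\<close>. The noise level cancels
  as both vectors are unit, and the squared distance \<open>2 - 2 (x . a)^2\<close> is at most
  \<open>8 \<delta>\<close>.\<close>

lemma maximizer_close_to_spike:
  assumes x: "sq_norm d x = 1" and a: "sq_norm d a = 1"
    and dev_x: "\<bar>bilin d E x x - bilin d (spiked_form \<theta> a) x x\<bar> \<le> 2 * \<delta>"
    and dev_a: "\<bar>bilin d E a a - bilin d (spiked_form \<theta> a) a a\<bar> \<le> 2 * \<delta>"
    and max: "bilin d E a a \<le> bilin d E x x"
  shows "frobenius_norm (outer (vec d x) - outer (vec d a)) \<le> sqrt (8 * \<delta>)"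
proof -
  have "(\<Sum>i<d. a i * a i) = 1" using a by (simp add: sq_norm_def power2_eq_square)
  then have "(\<Sum>i<d. x i * a i)\<^sup>2 \<ge> 1 - 4 * \<delta>"
    using assms unfolding bilin_spiked_form by simp
  then show ?thesis using x a by (simp add: frobenius_norm_outer_diff)
qed

text \<open>No far vector is a maximizer exactly if each one is strictly beaten; this is the shape
  of \<open>beaten_event_sets\<close>.\<close>

lemma recovery_event_eq:
  assumes Y: "Y \<in> carrier_mat d d"
  shows "(\<forall>u. solves_vector k d Y u \<longrightarrow> frobenius_norm (outer u - outer (vec d a)) < \<epsilon>) \<longleftrightarrow>
    (\<forall>x\<in>{x \<in> sparse_fun k d. \<epsilon> \<le> frobenius_norm (outer (vec d x) - outer (vec d a))}.
      \<exists>x'\<in>sparse_fun k d. bilin d (\<lambda>i j. Y $$ (i, j)) x x < bilin d (\<lambda>i j. Y $$ (i, j)) x' x')"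
  unfolding solves_vector_vec_iff[OF Y] by (force simp: not_less)

text \<open>Recovery asks for distance strictly below \<open>\<epsilon>\<close>, so the far vectors
  are cut out by a weak inequality and form a closed subset.\<close>

lemma compact_far_sparse_fun:
  "compact {x \<in> sparse_fun k d. \<epsilon> \<le> frobenius_norm (outer (vec d x) - outer (vec d a))}"
proof -
  have "closed {x. \<epsilon> \<le> frobenius_norm (outer (vec d x) - outer (vec d a))}"
    unfolding frobenius_norm_outer_diff
    by (intro closed_Collect_le continuous_intros continuous_on_sq_norm
        continuous_on_product_coordinates)
  from compact_Int_closed[OF compact_sparse_fun this] show ?thesis
    by (simp add: Int_def)
qed

text \<open>Measurability has to be proved, since the event quantifies over uncountably many vectors
  and its probability is later bounded below by monotonicity.\<close>

lemma recovery_event_sets: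
  fixes z :: "nat \<Rightarrow> 'a \<Rightarrow> real vec"
  assumes z: "\<And>i. i < n \<Longrightarrow> z i \<in> measurable M (vec_borel d)"
  shows "{\<omega> \<in> space M. \<forall>u. solves_vector k d (sample_cov d n (\<lambda>i. z i \<omega>)) u \<longrightarrow>
      frobenius_norm (outer u - outer (vec d a)) < \<epsilon>} \<in> sets M"
proof -
  have zc: "z i \<omega> \<in> carrier_vec d" if "i < n" "\<omega> \<in> space M" for i \<omega>
    using measurable_space[OF z] that by (simp add: space_vec_borel)
  have [measurable]: "(\<lambda>\<omega>. vec d x \<bullet> z i \<omega>) \<in> borel_measurable M" if "i < n" for x i
    using measurable_compose[OF z[OF that] measurable_vec_borel_scalar_prod] .
  have "(\<lambda>\<omega>. (\<Sum>i<n. (vec d x \<bullet> z i \<omega>)\<^sup>2) / real n) \<in> borel_measurable M" for x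
    by measurable
  moreover have "(\<lambda>\<omega>. bilin d (\<lambda>i j. sample_cov d n (\<lambda>i. z i \<omega>) $$ (i, j)) x x) \<in> borel_measurable M
      \<longleftrightarrow> (\<lambda>\<omega>. (\<Sum>i<n. (vec d x \<bullet> z i \<omega>)\<^sup>2) / real n) \<in> borel_measurable M" for x
    by (intro measurable_cong bilin_sample_cov zc)
  ultimately have "(\<lambda>\<omega>. bilin d (\<lambda>i j. sample_cov d n (\<lambda>i. z i \<omega>) $$ (i, j)) x x) \<in> borel_measurable M" for x
    by blast
  then show ?thesis
    unfolding recovery_event_eq[OF sample_cov_carrier]
    by (intro beaten_event_sets compact_far_sparse_fun continuous_on_bilin)
qed

section \<open>Probability bound and passage to the limit\<close>

lemma grid_card_le_exp:
  assumes "d \<ge> 2"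
  shows "real ((2 * d + 1) ^ (16 * k)) \<le> exp (48 * (real k * ln (real d)))"
proof -
  \<comment> \<open>From \<open>d = 2\<close> on, the cube absorbs the constants, so that
    \<open>ln d\<close> alone controls the grid size; the exponent becomes
    \<open>3 * 16 * k = 48 * k\<close>.\<close>
  have "2 * d + 1 \<le> d ^ 3"
  proof -
    have "d * (d * d) \<ge> d * (2 * 2)" using assms by (intro mult_mono) auto
    moreover have "d ^ 3 = d * (d * d)" by (simp add: power3_eq_cube)
    ultimately show ?thesis using assms by linarith
  qed
  then have "(2 * d + 1) ^ (16 * k) \<le> (d ^ 3) ^ (16 * k)" by (rule power_mono) simp
  also have "\<dots> = d ^ (48 * k)" by (simp flip: power_mult)
  finally have "real ((2 * d + 1) ^ (16 * k)) \<le> real d ^ (48 * k)"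
    by (metis of_nat_le_iff of_nat_power)
  also have "\<dots> = exp (real (48 * k) * ln (real d))"
    using assms by (simp only: exp_of_nat_mult) simp
  finally show ?thesis by (simp add: mult_ac)
qed

text \<open>Off the exceptional event every maximizer lies within
  \<open>sqrt (8 * \<delta>) < \<epsilon>\<close> of the spike. The exponent isolates the ratio
  \<open>k * ln d / n\<close>, ready for the limit.\<close>

lemma (in prob_space) recovery_prob:
  fixes z :: "nat \<Rightarrow> 'a \<Rightarrow> real vec"
  assumes \<theta>: "0 \<le> \<theta>" "\<theta> < 1" and a: "a \<in> sparse_fun k d"
    and normal: "\<And>i. i < n \<Longrightarrow>
          normal_vec M d (0\<^sub>v d) (spiked_cov d \<theta> (outer (vec d a))) (z i)"
    and indep: "indep_vars (\<lambda>_. vec_borel d) z {..<n}"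
    and n: "n > 0" and \<delta>: "0 < \<delta>" "\<delta> \<le> 1" and \<epsilon>: "0 < \<epsilon>" "8 * \<delta> < \<epsilon>\<^sup>2"
  shows "prob {\<omega> \<in> space M. \<forall>u. solves_vector k d (sample_cov d n (\<lambda>i. z i \<omega>)) u \<longrightarrow>
      frobenius_norm (outer u - outer (vec d a)) < \<epsilon>}
    \<ge> 1 - 2 * exp (real n * (48 * (real k * ln (real d) / real n) - \<delta>\<^sup>2 / 64))" (is "prob ?R \<ge> 1 - ?b")
proof -
  have z: "z i \<in> measurable M (vec_borel d)" if "i < n" for i
    using normal[OF that] by (simp add: normal_vec_def)
  have R: "?R \<in> events" using z by (rule recovery_event_sets)
  have a1: "sq_norm d a = 1" using a by (simp add: sparse_fun_def)
  show ?thesis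
  \<comment> \<open>In dimension 1, the ratio hypothesis is void since ln 1 = 0, but a a^T is the only candidate.\<close>
  proof (cases "d = 1")
    case True
    have "frobenius_norm (outer u - outer (vec d a)) < \<epsilon>"
      if u: "solves_vector k d (sample_cov d n (\<lambda>i. z i \<omega>)) u" for \<omega> u
    proof -
      from u obtain x where x: "x \<in> sparse_fun k d" "u = vec d x"
        unfolding solves_vector_vec_iff[OF sample_cov_carrier] by blast
      have "(x 0)\<^sup>2 = 1" "(a 0)\<^sup>2 = 1" using x(1) a True by (simp_all add: sparse_fun_def sq_norm_def)
      then show ?thesis
        unfolding x(2) frobenius_norm_outer_diff using \<epsilon> True
        by (simp add: sq_norm_def power_mult_distrib)
    qed
    then have "?R = space M" by blast
    then show ?thesis by (simp add: prob_space)
  next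
    case False
    then have d: "d \<ge> 2" using sparse_fun_pos[OF a] by simp
    obtain B where B: "B \<in> events"
      "prob B \<le> 2 * real ((2 * d + 1) ^ (16 * k)) * exp (- (real n * \<delta>\<^sup>2 / 64))"
      "\<forall>\<omega>\<in>space M - B. \<forall>x\<in>sparse_fun k d.
         \<bar>bilin d (\<lambda>i j. sample_cov d n (\<lambda>i. z i \<omega>) $$ (i, j)) x x - bilin d (spiked_form \<theta> a) x x\<bar> \<le> 2 * \<delta>"
      by (rule sample_cov_concentration[OF \<theta> a _ indep n \<delta>])
        (erule normal, (rule that; assumption))
    have "space M - B \<subseteq> ?R"
    proof (safe)
      fix \<omega> u assume \<omega>: "\<omega> \<in> space M" "\<omega> \<notin> B"
        and "solves_vector k d (sample_cov d n (\<lambda>i. z i \<omega>)) u"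
      then obtain x where x: "x \<in> sparse_fun k d" "u = vec d x"
        and max: "\<forall>x'\<in>sparse_fun k d. bilin d (\<lambda>i j. sample_cov d n (\<lambda>i. z i \<omega>) $$ (i, j)) x' x'
          \<le> bilin d (\<lambda>i j. sample_cov d n (\<lambda>i. z i \<omega>) $$ (i, j)) x x"
        unfolding solves_vector_vec_iff[OF sample_cov_carrier] by blast
      have "frobenius_norm (outer u - outer (vec d a)) \<le> sqrt (8 * \<delta>)"
        unfolding x(2)
      proof (rule maximizer_close_to_spike[OF _ a1 _ _ max[rule_format, OF a]])
        show "sq_norm d x = 1" using x(1) by (simp add: sparse_fun_def)
      qed (use B(3) \<omega> x(1) a in blast)+
      also have "\<dots> < \<epsilon>" using \<epsilon> by (intro real_less_lsqrt) auto
      finally show "frobenius_norm (outer u - outer (vec d a)) < \<epsilon>" .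
    qed
    then have "prob (space M - B) \<le> prob ?R"
      using R by (rule finite_measure_mono)
    then have "1 - prob B \<le> prob ?R"
      by (simp only: prob_compl[OF B(1)])
    moreover have "prob B \<le> ?b"
    proof -
      have "2 * real ((2 * d + 1) ^ (16 * k)) \<le> 2 * exp (48 * (real k * ln (real d)))"
        using grid_card_le_exp[OF d] by (rule mult_left_mono) simp
      then have "2 * real ((2 * d + 1) ^ (16 * k)) * exp (- (real n * \<delta>\<^sup>2 / 64))
          \<le> 2 * exp (48 * (real k * ln (real d))) * exp (- (real n * \<delta>\<^sup>2 / 64))"
        by (rule mult_right_mono) simp
      also have "\<dots> = 2 * exp (48 * (real k * ln (real d)) + - (real n * \<delta>\<^sup>2 / 64))"
        by (simp only: exp_add mult.assoc)
      also have "48 * (real k * ln (real d)) + - (real n * \<delta>\<^sup>2 / 64)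
          = real n * (48 * (real k * ln (real d) / real n) - \<delta>\<^sup>2 / 64)"
        using n by (simp add: right_diff_distrib)
      finally show ?thesis using B(2) by (rule order.trans[rotated])
    qed
    ultimately show ?thesis by linarith
  qed
qed

text \<open>Recovery in the limit is read as convergence in probability in Frobenius norm. It is
  claimed for all maximizers, so the choice among ties, such as \<open>u\<close> and
  \<open>- u\<close>, does not matter; the first conjunct ensures that maximizers exist.\<close>

theorem proposition4p4:
  fixes M :: "nat \<Rightarrow> 'a measure"
    and z :: "nat \<Rightarrow> nat \<Rightarrow> 'a \<Rightarrow> real vec"
    and k d n :: "nat \<Rightarrow> nat"
    and A :: "nat \<Rightarrow> real mat"
    and \<theta> :: real
    and y :: "nat \<Rightarrow> 'a \<Rightarrow> real mat"
  assumes theta: "0 \<le> \<theta>" "\<theta> < 1"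
    and spike: "\<And>l. A l \<in> alphabet (k l) (d l)"
    and prob: "\<And>l. prob_space (M l)"
    and normal: "\<And>l i. i < n l \<Longrightarrow>
          normal_vec (M l) (d l) (0\<^sub>v (d l)) (spiked_cov (d l) \<theta> (A l)) (z l i)"
    and indep: "\<And>l. prob_space.indep_vars (M l) (\<lambda>_. vec_borel (d l)) (z l) {..<n l}"
    and y: "\<And>l \<omega>. y l \<omega> = sample_cov (d l) (n l) (\<lambda>i. z l i \<omega>)"
    and n_lim: "filterlim n at_top sequentially"
    and ratio: "(\<lambda>l. real (k l) * ln (real (d l)) / real (n l)) \<longlonglongrightarrow> 0"
  shows "(\<forall>l. \<forall>\<omega>\<in>space (M l). \<exists>B u.
            solves_matrix (k l) (d l) (y l \<omega>) B \<and> solves_vector (k l) (d l) (y l \<omega>) u \<and>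
            mat_inner (y l \<omega>) B = u \<bullet> (y l \<omega> *\<^sub>v u)) \<and>
         (\<forall>\<epsilon>>0. (\<lambda>l. measure (M l) {\<omega> \<in> space (M l).
            \<forall>B. solves_matrix (k l) (d l) (y l \<omega>) B \<longrightarrow>
                frobenius_norm (B - A l) < \<epsilon>}) \<longlonglongrightarrow> 1) \<and>
         (\<forall>\<epsilon>>0. (\<lambda>l. measure (M l) {\<omega> \<in> space (M l).
            \<forall>u. solves_vector (k l) (d l) (y l \<omega>) u \<longrightarrow>
                frobenius_norm (outer u - A l) < \<epsilon>}) \<longlonglongrightarrow> 1)"
proof -
  have "\<exists>a\<in>sparse_fun (k l) (d l). A l = outer (vec (d l) a)" for l
    using spike[of l] by (auto simp: alphabet_def sparse_unit_eq)
  then obtain a where a: "\<And>l. a l \<in> sparse_fun (k l) (d l)" and A: "\<And>l. A l = outer (vec (d l) (a l))"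
    by metis
  have yc: "y l \<omega> \<in> carrier_mat (d l) (d l)" for l \<omega> by (simp add: y)
  have ex: "\<exists>B u. solves_matrix (k l) (d l) (y l \<omega>) B \<and> solves_vector (k l) (d l) (y l \<omega>) u \<and>
      mat_inner (y l \<omega>) B = u \<bullet> (y l \<omega> *\<^sub>v u)" for l \<omega>
  proof -
    obtain u where u: "solves_vector (k l) (d l) (y l \<omega>) u"
      using solves_vector_exists[OF yc] a by blast
    then have "u \<in> carrier_vec (d l)"
      by (auto simp: solves_vector_def is_arg_max_def sparse_unit_def)
    then show ?thesis using u mat_inner_outer[OF yc] solves_matrix_iff[OF yc] by blast
  qed
  have lim: "(\<lambda>l. measure (M l) {\<omega> \<in> space (M l). \<forall>u. solves_vector (k l) (d l) (y l \<omega>) u \<longrightarrow>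
                frobenius_norm (outer u - A l) < \<epsilon>}) \<longlonglongrightarrow> 1"
    (is "(\<lambda>l. measure (M l) (?R l)) \<longlonglongrightarrow> 1") if \<epsilon>: "\<epsilon> > 0" for \<epsilon>
  proof -
    \<comment> \<open>The minimum with 1 meets the range of the tail bound, and
      \<open>\<epsilon>^2 / 16\<close> gives \<open>8 * \<delta> \<le> \<epsilon>^2 / 2\<close>,
      strictly below \<open>\<epsilon>^2\<close>.\<close>
    define \<delta> where "\<delta> = min 1 (\<epsilon>\<^sup>2 / 16)"
    have \<delta>: "0 < \<delta>" "\<delta> \<le> 1" "8 * \<delta> < \<epsilon>\<^sup>2" using \<epsilon> by (auto simp: \<delta>_def min_def)
    define r where "r l = real (k l) * ln (real (d l)) / real (n l)" for l
    \<comment> \<open>As \<open>6144 = 48 * 128\<close>, the grid term \<open>48 * r l\<close> uses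
      up at most half of \<open>\<delta>^2 / 64\<close>, and the exponent stays below
      \<open>- n * \<delta>^2 / 128\<close>.\<close>
    have r: "eventually (\<lambda>l. r l < \<delta>\<^sup>2 / 6144) sequentially"
      using \<delta> order_tendstoD(2)[OF ratio, of "\<delta>\<^sup>2 / 6144"] by (simp add: r_def)
    have n0: "eventually (\<lambda>l. n l > 0) sequentially"
      using filterlim_at_top[THEN iffD1, OF n_lim, rule_format, of 1] by eventually_elim simp
    have lower: "eventually (\<lambda>l. 1 - 2 * exp (- (\<delta>\<^sup>2 / 128) * real (n l)) \<le> measure (M l) (?R l)) sequentially"
      using r n0
    proof eventually_elim
      case (elim l)
      interpret prob_space "M l" by (rule prob)
      have "real (n l) * (48 * r l - \<delta>\<^sup>2 / 64) \<le> real (n l) * - (\<delta>\<^sup>2 / 128)"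
        using elim by (intro mult_left_mono) auto
      then have "1 - 2 * exp (- (\<delta>\<^sup>2 / 128) * real (n l)) \<le> 1 - 2 * exp (real (n l) * (48 * r l - \<delta>\<^sup>2 / 64))"
        by (simp add: mult_ac)
      also have "\<dots> \<le> measure (M l) (?R l)"
        unfolding r_def y A using theta a normal[unfolded A] indep elim \<delta> \<epsilon>
        by (intro recovery_prob) auto
      finally show ?case .
    qed
    have "filterlim (\<lambda>l. real (n l)) at_top sequentially"
      using n_lim by (rule filterlim_compose[OF filterlim_real_sequentially])
    then have "filterlim (\<lambda>l. - (\<delta>\<^sup>2 / 128) * real (n l)) at_bot sequentially"
      using \<delta> by (intro filterlim_tendsto_neg_mult_at_bot[OF tendsto_const]) auto
    then have "(\<lambda>l. exp (- (\<delta>\<^sup>2 / 128) * real (n l))) \<longlonglongrightarrow> 0"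
      by (rule filterlim_compose[OF exp_at_bot])
    then have "(\<lambda>l. 1 - 2 * exp (- (\<delta>\<^sup>2 / 128) * real (n l))) \<longlonglongrightarrow> 1 - 2 * 0"
      by (intro tendsto_intros)
    then have lower_lim: "(\<lambda>l. 1 - 2 * exp (- (\<delta>\<^sup>2 / 128) * real (n l))) \<longlonglongrightarrow> 1" by simp
    have upper: "eventually (\<lambda>l. measure (M l) (?R l) \<le> 1) sequentially"
      by (intro always_eventually allI prob_space.prob_le_1 prob)
    show ?thesis by (rule tendsto_sandwich[OF lower upper lower_lim tendsto_const])
  qed
  \<comment> \<open>Matrix maximizers are exactly the outer products of vector maximizers, so both
    recovery events coincide.\<close>
  have "(\<forall>B. solves_matrix (k l) (d l) (y l \<omega>) B \<longrightarrow> frobenius_norm (B - A l) < \<epsilon>) \<longleftrightarrow>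
      (\<forall>u. solves_vector (k l) (d l) (y l \<omega>) u \<longrightarrow> frobenius_norm (outer u - A l) < \<epsilon>)" for l \<omega> \<epsilon>
    using solves_matrix_iff[OF yc] by auto
  then show ?thesis using ex lim by simp
qed

end
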